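(* Let $\mathcal O$ be the ring of integers of a finite extension of $\mathbf Q_p$, with uniformizer $\varpi$ and residue field $\mathbf F$. Let $R$ and $S$ be complete local Noetherian $\mathcal O$-algebras with residue field $\mathbf F$, and suppose that $S$ is a finitely generated free $\mathcal O$-module. Suppose there exist a surjective $\mathcal O$-algebra map $\phi:R\twoheadrightarrow S$ inducing the identity on the residue fields and an element $\pi\in R$ such that the diagram $$\begin{array}{ccc}R&\xrightarrow{\ \phi\ }&S\\ \downarrow&&\downarrow\\ R/\pi R&\longrightarrow&S/\phi(\pi)S\end{array}$$ (with vertical maps the quotient maps) commutes. For $n\ge1$ write $\phi_n:R/\pi^nR\twoheadrightarrow S/\phi(\pi)^nS$ for the map induced by $\phi$. Assume $\#\,\phi(\pi)S/\phi(\pi)^2S<\infty$, and suppose that $\phi_1:R/\pi R\twoheadrightarrow S/\phi(\pi)S$ is an isomorphism. (i) If $R/\pi R\cong\mathcal O/\varpi^r$ for some positive integer $r$, then $\phi$ is an isomorphism. (ii) If $R/\pi R\cong\mathcal O$ and the induced map $\pi R/\pi^2R\twoheadrightarrow\phi(\pi)S/\phi(\pi)^2S$ is an isomorphism, then $\phi$ is an isomorphism. *)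

theory Defs
  imports
    "HOL-Algebra.Module"
    "HOL-Algebra.IntRing"
    "HOL-Algebra.QuotRing"
    "HOL-Algebra.Ideal_Product"
    "HOL-Algebra.Ring_Divisibility"
    "HOL-Algebra.Polynomials"
    "HOL-Algebra.Embedded_Algebras"
begin

section \<open>Adic completions\<close>

text \<open>The power of an ideal is taken in the multiplicative monoid of ideals, so the zeroth power
  is the unit ideal.\<close>

abbreviation ideal_pow :: "('a, 'm) ring_scheme \<Rightarrow> 'a set \<Rightarrow> nat \<Rightarrow> 'a set"
  where "ideal_pow R I n \<equiv> I [^]\<^bsub>ideals_set R\<^esub> n"

text \<open>The inverse limit of the rings \<open>R / I\<^sup>n\<close>. The transition map sends a coset of \<open>I\<^sup>n\<^sup>+\<^sup>1\<close> to the
  unique coset of \<open>I\<^sup>n\<close> containing it, so compatibility is inclusion of cosets.\<close>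

definition adic_completion :: "('a, 'm) ring_scheme \<Rightarrow> 'a set \<Rightarrow> (nat \<Rightarrow> 'a set) ring"
  where "adic_completion R I =
    \<lparr>carrier = {x. (\<forall>n. x n \<in> carrier (R Quot (ideal_pow R I n))) \<and> (\<forall>n. x (Suc n) \<subseteq> x n)},
     mult = (\<lambda>x y n. x n \<otimes>\<^bsub>R Quot (ideal_pow R I n)\<^esub> y n),
     one = (\<lambda>n. \<one>\<^bsub>R Quot (ideal_pow R I n)\<^esub>),
     zero = (\<lambda>n. \<zero>\<^bsub>R Quot (ideal_pow R I n)\<^esub>),
     add = (\<lambda>x y n. x n \<oplus>\<^bsub>R Quot (ideal_pow R I n)\<^esub> y n)\<rparr>"

section \<open>Rings of integers of finite extensions of the p-adic numbers\<close>

definition padic_integers :: "nat \<Rightarrow> (nat \<Rightarrow> int set) ring"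
  where "padic_integers p = adic_completion \<Z> (PIdl\<^bsub>\<Z>\<^esub> (int p))"

text \<open>An embedding of the fraction field of a domain \<open>A\<close> into a field \<open>K\<close> is the same as an injective
  homomorphism \<open>\<iota>\<close> from \<open>A\<close> to \<open>K\<close>; the image of the fraction field is the set of quotients.\<close>

definition fractions ::
    "('a, 'm) ring_scheme \<Rightarrow> ('k, 'n) ring_scheme \<Rightarrow> ('a \<Rightarrow> 'k) \<Rightarrow> 'k set"
  where "fractions A K \<iota> =
    {\<iota> a \<otimes>\<^bsub>K\<^esub> inv\<^bsub>K\<^esub> (\<iota> b) | a b. a \<in> carrier A \<and> b \<in> carrier A \<and> b \<noteq> \<zero>\<^bsub>A\<^esub>}"

definition finite_padic_extension :: "nat \<Rightarrow> 'k ring \<Rightarrow> ((nat \<Rightarrow> int set) \<Rightarrow> 'k) \<Rightarrow> bool"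
  where "finite_padic_extension p K \<iota> \<longleftrightarrow>
    field K \<and>
    \<iota> \<in> ring_hom (padic_integers p) K \<and>
    inj_on \<iota> (carrier (padic_integers p)) \<and>
    ring.finite_dimension K (fractions (padic_integers p) K \<iota>) (carrier K)"

definition integral_closure :: "'k set \<Rightarrow> 'k ring \<Rightarrow> 'k ring"
  where "integral_closure A K = K\<lparr>carrier :=
    {x \<in> carrier K. \<exists>q. polynomial\<^bsub>K\<^esub> A q \<and> q \<noteq> [] \<and> lead_coeff q = \<one>\<^bsub>K\<^esub> \<and>
                        ring.eval K q x = \<zero>\<^bsub>K\<^esub>}\<rparr>"

definition ring_of_integers :: "nat \<Rightarrow> 'k ring \<Rightarrow> ((nat \<Rightarrow> int set) \<Rightarrow> 'k) \<Rightarrow> 'k ring"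
  where "ring_of_integers p K \<iota> = integral_closure (\<iota> ` carrier (padic_integers p)) K"

text \<open>To be applied to a discrete valuation ring, whose maximal ideal is unique.\<close>

definition uniformizer :: "('a, 'm) ring_scheme \<Rightarrow> 'a \<Rightarrow> bool"
  where "uniformizer A varpi \<longleftrightarrow> varpi \<in> carrier A \<and> maximalideal (PIdl\<^bsub>A\<^esub> varpi) A"

section \<open>Quotients and induced maps\<close>

text \<open>The map from cosets of \<open>I\<close> to cosets of \<open>J\<close> in \<open>S\<close> induced by a homomorphism \<open>f\<close> carrying
  \<open>I\<close> into \<open>J\<close>: on such a coset the inner image is a singleton.\<close>

definition quot_map ::
    "('b, 'n) ring_scheme \<Rightarrow> 'b set \<Rightarrow> ('a \<Rightarrow> 'b) \<Rightarrow> 'a set \<Rightarrow> 'b set"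
  where "quot_map S J f = (\<lambda>C. the_elem ((\<lambda>x. J +>\<^bsub>S\<^esub> f x) ` C))"

definition phi_n ::
    "('b, 'n) ring_scheme \<Rightarrow> ('a \<Rightarrow> 'b) \<Rightarrow> 'a \<Rightarrow> nat \<Rightarrow> 'a set \<Rightarrow> 'b set"
  where "phi_n S \<phi> \<pi> n = quot_map S (PIdl\<^bsub>S\<^esub> (\<phi> \<pi> [^]\<^bsub>S\<^esub> n)) \<phi>"

text \<open>The additive group \<open>aR / a\<^sup>2R\<close>.\<close>

definition principal_subquotient :: "('a, 'm) ring_scheme \<Rightarrow> 'a \<Rightarrow> 'a set monoid"
  where "principal_subquotient R a =
    (R\<lparr>carrier := PIdl\<^bsub>R\<^esub> a\<rparr>) A_Mod (PIdl\<^bsub>R\<^esub> (a [^]\<^bsub>R\<^esub> (2::nat)))"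

section \<open>Algebras over a commutative ring\<close>

definition regular_algebra :: "('a, 'm) ring_scheme \<Rightarrow> ('a, 'a) module"
  where "regular_algebra A =
    \<lparr>carrier = carrier A, mult = mult A, one = \<one>\<^bsub>A\<^esub>, zero = \<zero>\<^bsub>A\<^esub>, add = add A,
     smult = mult A\<rparr>"

definition quotient_algebra :: "('a, 'r) module \<Rightarrow> 'r set \<Rightarrow> ('a, 'r set) module"
  where "quotient_algebra R I =
    \<lparr>carrier = carrier (R Quot I), mult = mult (R Quot I), one = \<one>\<^bsub>R Quot I\<^esub>,
     zero = \<zero>\<^bsub>R Quot I\<^esub>, add = add (R Quot I),
     smult = (\<lambda>a C. \<Union>x\<in>C. I +>\<^bsub>R\<^esub> (a \<odot>\<^bsub>R\<^esub> x))\<rparr>"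

definition algebra_hom ::
    "('a, 'm) ring_scheme \<Rightarrow> ('a, 'r) module \<Rightarrow> ('a, 's) module \<Rightarrow> ('r \<Rightarrow> 's) set"
  where "algebra_hom A R S =
    {h \<in> ring_hom R S. \<forall>a\<in>carrier A. \<forall>x\<in>carrier R. h (a \<odot>\<^bsub>R\<^esub> x) = a \<odot>\<^bsub>S\<^esub> h x}"

definition algebra_iso ::
    "('a, 'm) ring_scheme \<Rightarrow> ('a, 'r) module \<Rightarrow> ('a, 's) module \<Rightarrow> ('r \<Rightarrow> 's) set"
  where "algebra_iso A R S = {h \<in> algebra_hom A R S. bij_betw h (carrier R) (carrier S)}"

definition structure_map :: "('a, 'r) module \<Rightarrow> 'a \<Rightarrow> 'r"
  where "structure_map R a = a \<odot>\<^bsub>R\<^esub> \<one>\<^bsub>R\<^esub>"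

definition finite_free_module :: "('a, 'm) ring_scheme \<Rightarrow> ('a, 'r) module \<Rightarrow> bool"
  where "finite_free_module A M \<longleftrightarrow> module A M \<and>
    (\<exists>(n::nat) b. b \<in> {..<n} \<rightarrow> carrier M \<and>
      (\<forall>x\<in>carrier M. \<exists>!c. c \<in> {..<n} \<rightarrow>\<^sub>E carrier A \<and>
         x = (\<Oplus>\<^bsub>M\<^esub>i\<in>{..<n}. c i \<odot>\<^bsub>M\<^esub> b i)))"

section \<open>Complete local Noetherian algebras\<close>

definition local_ring :: "('a, 'm) ring_scheme \<Rightarrow> bool"
  where "local_ring R \<longleftrightarrow> cring R \<and> (\<exists>!M. maximalideal M R)"

definition max_ideal :: "('a, 'm) ring_scheme \<Rightarrow> 'a set"
  where "max_ideal R = (THE M. maximalideal M R)"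

definition adically_complete :: "('a, 'm) ring_scheme \<Rightarrow> 'a set \<Rightarrow> bool"
  where "adically_complete R I \<longleftrightarrow>
    (\<lambda>x n. ideal_pow R I n +>\<^bsub>R\<^esub> x) \<in> ring_iso R (adic_completion R I)"

text \<open>The map on residue fields induced by the structure map of an algebra \<open>R\<close> over a ring
  with maximal ideal \<open>\<mm>\<close>.\<close>

definition residue_map :: "('a, 'r) module \<Rightarrow> 'a set \<Rightarrow> 'r set"
  where "residue_map R = quot_map R (max_ideal R) (structure_map R)"

text \<open>Here \<open>\<mm>\<close> is the maximal ideal of \<open>A\<close>. Having residue field \<open>A/\<mm>\<close> means that the structure map
  is local and induces an isomorphism on residue fields; this isomorphism is the
  identification of the residue field of \<open>R\<close> with \<open>A/\<mm>\<close>.\<close>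

definition complete_local_noetherian_algebra ::
    "('a, 'm) ring_scheme \<Rightarrow> 'a set \<Rightarrow> ('a, 'r) module \<Rightarrow> bool"
  where "complete_local_noetherian_algebra A \<mm> R \<longleftrightarrow>
    algebra A R \<and> noetherian_ring R \<and> local_ring R \<and> adically_complete R (max_ideal R) \<and>
    structure_map R ` \<mm> \<subseteq> max_ideal R \<and>
    residue_map R \<in> ring_iso (A Quot \<mm>) (R Quot (max_ideal R))"

definition identity_on_residue_fields ::
    "('a, 'm) ring_scheme \<Rightarrow> 'a set \<Rightarrow> ('a, 'r) module \<Rightarrow> ('a, 's) module \<Rightarrow> ('r \<Rightarrow> 's) \<Rightarrow> bool"
  where "identity_on_residue_fields A \<mm> R S \<phi> \<longleftrightarrow>
    \<phi> ` max_ideal R \<subseteq> max_ideal S \<and>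
    (\<forall>C\<in>carrier (A Quot \<mm>). quot_map S (max_ideal S) \<phi> (residue_map R C) = residue_map S C)"

end

theory Submission
  imports Defs
begin

text \<open>Let \<open>N\<close> be the kernel of \<open>\<phi>\<close> and put \<open>t = \<phi> \<pi>\<close>. Both assertions follow from the equality \<open>N = \<pi>N\<close>. The
  quotient \<open>R/\<pi>R\<close> is nonzero in both cases, so \<open>\<pi>\<close> lies in the maximal ideal \<open>\<mm>\<close> of \<open>R\<close>; iterating the
  equality puts \<open>N\<close> into every power of \<open>\<mm>\<close>, and these intersect in zero because \<open>R\<close> is complete
  (\<open>inj_if_kernel_divisible\<close>).

  Injectivity of \<open>\<phi>\<^sub>1\<close> gives \<open>N \<subseteq> \<pi>R\<close>. In the first case \<open>\<varpi>\<^sup>r\<close> kills \<open>R/\<pi>R\<close>, so its image in \<open>S\<close> is a multiple of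
  \<open>t\<close>. It is a nonzerodivisor, \<open>S\<close> being free and \<open>\<varpi>\<close> nonzero; hence so is \<open>t\<close>. If \<open>\<pi>y \<in> N\<close>, then
  \<open>t \<cdot> \<phi> y = 0\<close> and therefore \<open>y \<in> N\<close>.

  In the second case \<open>S/tS\<close> is free of rank one, so \<open>t\<close> is a zero divisor. But injectivity of
  \<open>\<phi>\<^sub>2\<close> now puts \<open>N\<close> into \<open>\<pi>\<^sup>2R\<close>, and \<open>t\<close> still acts injectively on \<open>tS\<close>: the group \<open>tS/t\<^sup>2S\<close> is
  finite, so some positive integer kills it, and positive integers are nonzerodivisors on \<open>S\<close>. If \<open>\<pi>\<^sup>2z \<in> N\<close>, then \<open>t \<cdot> (t \<cdot> \<phi> z) = 0\<close>, so
  \<open>t \<cdot> \<phi> z = 0\<close>, that is, \<open>\<pi>z \<in> N\<close>.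

  In both cases injectivity of \<open>t\<close> on an ideal of \<open>S\<close> is deduced from the fact that its cokernel there is
  torsion (\<open>inj_mult_if_cokernel_killed\<close>). From the ring of integers the argument uses that it is a domain
  of characteristic zero and that it is not a field, so that \<open>\<varpi>\<close> is nonzero. The latter holds because \<open>1/p\<close>
  is not integral over the \<open>p\<close>-adic integers (\<open>inv_p_not_integral\<close>).\<close>

section \<open>Ideals in Noetherian rings\<close>

text \<open>The annihilators of the powers of \<open>t\<close> form an ascending chain of ideals.\<close>

lemma power_annihilators_stabilize:
  fixes S (structure)
  assumes "cring S" "noetherian_ring S" and t: "t \<in> carrier S"
  shows "\<exists>k::nat. \<forall>x\<in>carrier S. t [^] Suc k \<otimes> x = \<zero> \<longrightarrow> t [^] k \<otimes> x = \<zero>"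
proof -
  interpret cring S by fact
  interpret noetherian_ring S by fact
  define I where "I = (\<lambda>k::nat. {x \<in> carrier S. t [^] k \<otimes> x = \<zero>})"
  have ideal_I: "ideal (I k) S" for k
  proof (rule idealI[OF ring_axioms])
    show "subgroup (I k) (add_monoid S)"
      by (rule add.subgroupI) (use t in \<open>auto simp: I_def r_distr r_minus\<close>)
  qed (use t in \<open>auto simp: I_def m_lcomm m_assoc[symmetric], simp_all add: m_comm m_lcomm\<close>)
  have step: "I k \<subseteq> I (Suc k)" for k
    using t by (auto simp: I_def m_comm[of _ t] m_assoc)
  have mono: "I k \<subseteq> I l" if "k \<le> l" for k l
    using that by (rule lift_Suc_mono_le[of I, OF step])
  have "subset.chain {J. ideal J S} (range I)"
    unfolding subset_chain_def using ideal_I mono by (auto, meson mono nle_le subsetD)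
  then have "\<Union>(range I) \<in> range I"
    using ideal_chain_is_trivial[of "range I"] by blast
  then obtain k where "\<Union>(range I) = I k" by blast
  then have "I (Suc k) \<subseteq> I k" by blast
  then show ?thesis by (auto simp: I_def subset_iff)
qed

text \<open>The hypothesis is \<open>cM \<subseteq> tM\<close>. If \<open>M\<close> is a lattice over a discrete valuation ring and stable under \<open>t\<close>,
  it says that the endomorphism \<open>t\<close> of \<open>M\<close> has torsion cokernel, and comparing ranks shows that \<open>t\<close> is
  injective. The chain condition gives the same without linear algebra. Write
  \<open>c\<^sup>k x = t\<^sup>k y\<close> with \<open>y \<in> M\<close>, for \<open>k\<close> so large that the annihilators of \<open>t\<^sup>k\<close> and \<open>t\<^sup>k\<^sup>+\<^sup>1\<close> agree. If
  \<open>t x = 0\<close>, then \<open>t\<^sup>k\<^sup>+\<^sup>1 y = c\<^sup>k t x = 0\<close>, hence \<open>c\<^sup>k x = t\<^sup>k y = 0\<close> and \<open>x = 0\<close>.\<close>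

lemma inj_mult_if_cokernel_killed:
  fixes S (structure)
  assumes S: "cring S" "noetherian_ring S" and M: "M \<subseteq> carrier S"
    and c: "c \<in> carrier S" "\<And>x. x \<in> carrier S \<Longrightarrow> c \<otimes> x = \<zero> \<Longrightarrow> x = \<zero>"
    and t: "t \<in> carrier S"
    and killed: "\<And>x. x \<in> M \<Longrightarrow> \<exists>y\<in>M. c \<otimes> x = t \<otimes> y"
    and x: "x \<in> M" "t \<otimes> x = \<zero>"
  shows "x = \<zero>"
proof -
  interpret cring S by fact
  obtain k :: nat where k: "\<And>x. x \<in> carrier S \<Longrightarrow> t [^] Suc k \<otimes> x = \<zero> \<Longrightarrow> t [^] k \<otimes> x = \<zero>"
    using power_annihilators_stabilize[OF S t] by blast
  have xS: "x \<in> carrier S" using x M by blast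
  have "\<exists>y\<in>M. c [^] n \<otimes> x = t [^] n \<otimes> y" for n :: nat
  proof (induction n)
    case 0
    then show ?case using x by auto
  next
    case (Suc n)
    then obtain y where y: "y \<in> M" "c [^] n \<otimes> x = t [^] n \<otimes> y" by blast
    obtain z where z: "z \<in> M" "c \<otimes> y = t \<otimes> z" using killed[OF y(1)] by blast
    have carr: "y \<in> carrier S" "z \<in> carrier S" using y z M by auto
    have "c [^] Suc n \<otimes> x = c \<otimes> (c [^] n \<otimes> x)"
      using c(1) xS by (simp add: m_comm[of _ c] m_assoc)
    also have "\<dots> = t [^] n \<otimes> (c \<otimes> y)"
      using c(1) t carr by (simp add: y(2) m_lcomm)
    also have "\<dots> = t [^] Suc n \<otimes> z"
      using t carr by (simp add: z(2) m_assoc)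
    finally show ?case using z(1) by blast
  qed
  then obtain y where y: "y \<in> M" "c [^] k \<otimes> x = t [^] k \<otimes> y" by blast
  have yS: "y \<in> carrier S" using y M by blast
  have "t [^] Suc k \<otimes> y = t \<otimes> (c [^] k \<otimes> x)"
    using t yS by (simp add: y(2) m_comm[of _ t] m_assoc)
  also have "\<dots> = \<zero>"
    using t c(1) xS x(2) by (simp add: m_lcomm[of t])
  finally have "c [^] k \<otimes> x = \<zero>" using k[OF yS] y(2) by simp
  moreover have "c [^] n \<otimes> x = \<zero> \<Longrightarrow> x = \<zero>" for n :: nat
  proof (induction n)
    case 0
    then show ?case using xS by simp
  next
    case (Suc n)
    have "c \<otimes> (c [^] n \<otimes> x) = \<zero>"
      using Suc.prems c(1) xS by (simp add: m_comm[of _ c] m_assoc)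
    then have "c [^] n \<otimes> x = \<zero>" using c(2)[of "c [^] n \<otimes> x"] c(1) xS by simp
    then show ?case by (rule Suc.IH)
  qed
  ultimately show ?thesis by blast
qed

text \<open>Zorn's lemma applies to the proper ideals above \<open>I\<close>: by the chain condition, a chain of them
  contains its own union.\<close>

lemma proper_ideal_subset_maximal:
  assumes "noetherian_ring R" and I: "ideal I R" "I \<noteq> carrier R"
  shows "\<exists>M. maximalideal M R \<and> I \<subseteq> M"
proof -
  interpret noetherian_ring R by fact
  define P where "P = {J. ideal J R \<and> I \<subseteq> J \<and> J \<noteq> carrier R}"
  have "\<exists>M\<in>P. \<forall>J\<in>P. M \<subseteq> J \<longrightarrow> J = M"
  proof (rule subset_Zorn_nonempty)
    show "P \<noteq> {}" using I by (auto simp: P_def)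
  next
    fix C assume C: "C \<noteq> {}" "subset.chain P C"
    then have "subset.chain {J. ideal J R} C"
      by (auto simp: subset_chain_def P_def)
    then have "\<Union>C \<in> C" using ideal_chain_is_trivial C(1) by blast
    then show "\<Union>C \<in> P" using C(2) by (auto simp: subset_chain_def)
  qed
  then obtain M where M: "M \<in> P" and max: "\<And>J. J \<in> P \<Longrightarrow> M \<subseteq> J \<Longrightarrow> J = M" by blast
  have "maximalideal M R"
  proof (rule maximalidealI)
    show "ideal M R" "carrier R \<noteq> M" using M by (auto simp: P_def)
    fix J assume "ideal J R" "M \<subseteq> J" "J \<subseteq> carrier R"
    then show "J = M \<or> J = carrier R" using max[of J] M by (auto simp: P_def)
  qed
  then show ?thesis using M by (auto simp: P_def)
qed

lemma max_ideal_maximal: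
  assumes "local_ring R"
  shows "maximalideal (max_ideal R) R"
  using assms unfolding local_ring_def max_ideal_def by (elim conjE theI')

lemma nonunit_in_max_ideal:
  assumes "local_ring R" "noetherian_ring R" "a \<in> carrier R" "PIdl\<^bsub>R\<^esub> a \<noteq> carrier R"
  shows "a \<in> max_ideal R"
proof -
  interpret cring R using assms(1) by (simp add: local_ring_def)
  obtain M where "maximalideal M R" "PIdl\<^bsub>R\<^esub> a \<subseteq> M"
    using proper_ideal_subset_maximal[OF assms(2) cgenideal_ideal[OF assms(3)] assms(4)] by blast
  moreover have "M = max_ideal R"
    using assms(1) max_ideal_maximal[OF assms(1)] calculation(1) by (auto simp: local_ring_def)
  ultimately show ?thesis using cgenideal_self[OF assms(3)] by blast
qed

section \<open>Adic completions\<close>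

text \<open>The canonical homomorphism from a ring to its completion.\<close>

definition adic_map :: "('a, 'm) ring_scheme \<Rightarrow> 'a set \<Rightarrow> 'a \<Rightarrow> nat \<Rightarrow> 'a set"
  where "adic_map R I = (\<lambda>x n. ideal_pow R I n +>\<^bsub>R\<^esub> x)"

lemma ideal_pow_0: "ideal_pow R I 0 = carrier R"
  by (simp add: ideals_set_def)

lemma ideal_pow_Suc: "ideal_pow R I (Suc n) = ideal_prod R (ideal_pow R I n) I"
  by (simp add: ideals_set_def)

context
  fixes R (structure) and I
  assumes R: "cring R" and I: "ideal I R"
begin

interpretation cring R by (rule R)

lemma ideal_pow_ideal: "ideal (ideal_pow R I n) R"
  by (induction n) (simp_all only: ideal_pow_0 ideal_pow_Suc oneideal ideal_prod_is_ideal I)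

text \<open>This is what makes the sequences in the image of the canonical map, and the sums and products of
  compatible sequences, compatible again.\<close>

lemma ideal_pow_decreasing: "ideal_pow R I (Suc n) \<subseteq> ideal_pow R I n"
  using ideal_prod_inter[OF ideal_pow_ideal I] by (simp only: ideal_pow_Suc) blast

lemma coset_mono: "J \<subseteq> J' \<Longrightarrow> J +> x \<subseteq> J' +> x"
  by (auto simp: a_r_coset_def')

lemma adic_map_hom: "adic_map R I \<in> ring_hom R (adic_completion R I)"
proof -
  have hom: "(+>) (ideal_pow R I n) \<in> ring_hom R (R Quot (ideal_pow R I n))" for n
    by (rule ideal.rcos_ring_hom[OF ideal_pow_ideal])
  show ?thesis
    by (rule ring_hom_memI)
      (use ring_hom_closed[OF hom] ring_hom_mult[OF hom] ring_hom_add[OF hom] ring_hom_one[OF hom]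
        coset_mono[OF ideal_pow_decreasing] in \<open>auto simp: adic_map_def adic_completion_def\<close>)
qed

lemma adic_completion_closed:
  assumes "x \<in> carrier (adic_completion R I)" "y \<in> carrier (adic_completion R I)"
  shows "x \<oplus>\<^bsub>adic_completion R I\<^esub> y \<in> carrier (adic_completion R I)"
    and "x \<otimes>\<^bsub>adic_completion R I\<^esub> y \<in> carrier (adic_completion R I)"
proof -
  have quot: "ring (R Quot (ideal_pow R I n))" for n
    by (rule ideal.quotient_is_ring[OF ideal_pow_ideal])
  have xy: "x n \<in> carrier (R Quot (ideal_pow R I n))" "x (Suc n) \<subseteq> x n"
    "y n \<in> carrier (R Quot (ideal_pow R I n))" "y (Suc n) \<subseteq> y n" for n
    using assms by (auto simp: adic_completion_def)
  have "x (Suc n) \<oplus>\<^bsub>R Quot (ideal_pow R I (Suc n))\<^esub> y (Suc n)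
      \<subseteq> x n \<oplus>\<^bsub>R Quot (ideal_pow R I n)\<^esub> y n" for n
    using xy(2,4)[of n] by (auto simp: FactRing_def set_add_def')
  then show "x \<oplus>\<^bsub>adic_completion R I\<^esub> y \<in> carrier (adic_completion R I)"
    using xy ring.ring_simprules(1)[OF quot] by (simp add: adic_completion_def)
  have "x (Suc n) \<otimes>\<^bsub>R Quot (ideal_pow R I (Suc n))\<^esub> y (Suc n)
      \<subseteq> x n \<otimes>\<^bsub>R Quot (ideal_pow R I n)\<^esub> y n" for n
    using xy(2,4)[of n] coset_mono[OF ideal_pow_decreasing[of n]]
    unfolding FactRing_def rcoset_mult_def by fastforce
  then show "x \<otimes>\<^bsub>adic_completion R I\<^esub> y \<in> carrier (adic_completion R I)"
    using xy ring.ring_simprules(5)[OF quot] by (simp add: adic_completion_def)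
qed

text \<open>Being complete includes that the canonical map is injective, and its kernel is the intersection of
  the powers of \<open>I\<close>.\<close>

lemma adically_complete_separated:
  assumes "adically_complete R I" "x \<in> carrier R" "\<And>n. x \<in> ideal_pow R I n"
  shows "x = \<zero>"
proof -
  have inj: "inj_on (adic_map R I) (carrier R)"
    using assms(1) by (simp add: adically_complete_def adic_map_def ring_iso_def bij_betw_def)
  have "ideal_pow R I n +> x = ideal_pow R I n +> \<zero>" for n
    using ideal_pow_ideal[of n] assms(3)[of n]
    by (metis abelian_subgroup.a_rcos_const abelian_subgroupI3 additive_subgroup.zero_closed
        ideal.axioms(1) is_abelian_group)
  then have "adic_map R I x = adic_map R I \<zero>" by (simp add: adic_map_def)
  then show ?thesis using inj assms(2) by (auto dest: inj_onD)
qed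

text \<open>This takes the place of Nakayama's lemma: from \<open>N \<subseteq> N a\<close> and \<open>a \<in> I\<close> it follows that \<open>N\<close> lies in every
  power of \<open>I\<close>.\<close>

lemma divisible_subset_trivial:
  assumes "adically_complete R I" "N \<subseteq> carrier R" "a \<in> I"
    and div: "\<And>x. x \<in> N \<Longrightarrow> \<exists>y\<in>N. x = y \<otimes> a"
  shows "N \<subseteq> {\<zero>}"
proof
  fix x assume x: "x \<in> N"
  have "N \<subseteq> ideal_pow R I n" for n
  proof (induction n)
    case 0
    then show ?case using assms(2) by (simp only: ideal_pow_0)
  next
    case (Suc n)
    show ?case
    proof
      fix x assume "x \<in> N"
      then obtain y where "y \<in> N" "x = y \<otimes> a" using div by blast
      then show "x \<in> ideal_pow R I (Suc n)"
        using Suc assms(3) by (auto simp only: ideal_pow_Suc intro: ideal_prod.prod)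
    qed
  qed
  then show "x \<in> {\<zero>}"
    using adically_complete_separated[OF assms(1)] x assms(2) by blast
qed

end

section \<open>Rings of integers\<close>

text \<open>Rational integers embed into the \<open>p\<close>-adic integers, and through them into \<open>K\<close>. Two facts about the
  ring of integers follow from this: it has characteristic zero, and \<open>p\<close> is not invertible in it.\<close>

abbreviation padic_of_int :: "nat \<Rightarrow> int \<Rightarrow> nat \<Rightarrow> int set"
  where "padic_of_int p \<equiv> adic_map \<Z> (PIdl\<^bsub>\<Z>\<^esub> (int p))"

lemma ideal_pow_int_subset: "ideal_pow \<Z> (PIdl\<^bsub>\<Z>\<^esub> a) n \<subseteq> {x. a ^ n dvd x}"
proof (induction n)
  case 0
  then show ?case by simp
next
  case (Suc n)
  show ?case
  proof
    fix x assume "x \<in> ideal_pow \<Z> (PIdl\<^bsub>\<Z>\<^esub> a) (Suc n)"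
    then have "x \<in> ideal_prod \<Z> (ideal_pow \<Z> (PIdl\<^bsub>\<Z>\<^esub> a) n) (PIdl\<^bsub>\<Z>\<^esub> a)"
      by (simp only: ideal_pow_Suc)
    then show "x \<in> {x. a ^ Suc n dvd x}"
    proof induction
      case (prod i j)
      then have "a ^ n dvd i" "a dvd j" using Suc by (auto simp: cgenideal_def)
      then show ?case using mult_dvd_mono[of "a ^ n" i a j] by (simp add: mult.commute)
    qed auto
  qed
qed

text \<open>An integer divisible by all powers of \<open>p\<close> vanishes; it suffices to look at the power whose exponent
  is the absolute value of the integer.\<close>

lemma padic_of_int_eq_iff:
  assumes "p \<ge> 2"
  shows "padic_of_int p m = padic_of_int p n \<longleftrightarrow> m = n"
proof
  assume eq: "padic_of_int p m = padic_of_int p n"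
  let ?I = "ideal_pow \<Z> (PIdl\<^bsub>\<Z>\<^esub> (int p))"
  have "int p ^ k dvd m - n" for k
  proof -
    have ideal: "ideal (?I k) \<Z>"
      by (intro ideal_pow_ideal int_is_cring int.cgenideal_ideal) simp
    have "?I k +>\<^bsub>\<Z>\<^esub> m = ?I k +>\<^bsub>\<Z>\<^esub> n"
      using fun_cong[OF eq, of k] by (simp add: adic_map_def)
    moreover have "0 \<in> ?I k"
      using additive_subgroup.zero_closed[OF ideal.axioms(1)[OF ideal]] by simp
    ultimately have "m \<in> ?I k +>\<^bsub>\<Z>\<^esub> n" by (force simp: a_r_coset_def')
    then have "m - n \<in> ?I k" by (auto simp: a_r_coset_def')
    then show ?thesis using ideal_pow_int_subset by blast
  qed
  then have "m - n \<noteq> 0 \<Longrightarrow> \<bar>int p ^ nat \<bar>m - n\<bar>\<bar> \<le> \<bar>m - n\<bar>"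
    by (intro dvd_imp_le_int)
  then have "m - n \<noteq> 0 \<Longrightarrow> int (p ^ nat \<bar>m - n\<bar>) \<le> int (nat \<bar>m - n\<bar>)" by simp
  moreover have "nat \<bar>m - n\<bar> < p ^ nat \<bar>m - n\<bar>"
    using assms by (intro power_gt_expt) auto
  ultimately have "\<not> m - n \<noteq> 0" by linarith
  then show "m = n" by simp
qed simp

context
  fixes p :: nat and K :: "'k ring" and \<iota> and A :: "(nat \<Rightarrow> int set) ring"
  assumes p: "Factorial_Ring.prime p" and ext: "finite_padic_extension p K \<iota>"
  defines "A \<equiv> padic_integers p"
begin

interpretation K: field K using ext by (simp add: finite_padic_extension_def)

lemma \<iota>_hom: "\<iota> \<in> ring_hom A K" and \<iota>_inj: "inj_on \<iota> (carrier A)"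
  using ext by (simp_all add: finite_padic_extension_def A_def)

lemma PIdl_p: "ideal (PIdl\<^bsub>\<Z>\<^esub> (int p)) \<Z>"
  by (rule int.cgenideal_ideal) simp

lemma padic_of_int_hom: "padic_of_int p \<in> ring_hom \<Z> A"
  using adic_map_hom[OF int_is_cring PIdl_p] by (simp add: A_def padic_integers_def)

lemma padic_of_int_closed: "padic_of_int p n \<in> carrier A"
  using ring_hom_closed[OF padic_of_int_hom] by simp

lemma padic_closed:
  "\<lbrakk>x \<in> carrier A; y \<in> carrier A\<rbrakk> \<Longrightarrow> x \<oplus>\<^bsub>A\<^esub> y \<in> carrier A"
  "\<lbrakk>x \<in> carrier A; y \<in> carrier A\<rbrakk> \<Longrightarrow> x \<otimes>\<^bsub>A\<^esub> y \<in> carrier A"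
  using adic_completion_closed[OF int_is_cring PIdl_p]
  by (simp_all add: A_def padic_integers_def)

lemma \<iota>_int_hom: "(\<lambda>n. \<iota> (padic_of_int p n)) \<in> ring_hom \<Z> K"
  using ring_hom_trans[OF padic_of_int_hom \<iota>_hom] by (simp add: comp_def)

lemma \<iota>_zero: "\<iota> (padic_of_int p 0) = \<zero>\<^bsub>K\<^esub>"
  using ring_hom_zero[OF \<iota>_int_hom cring.axioms(1)[OF int_is_cring] K.ring_axioms] by simp

lemma \<iota>_int_nonzero: "n \<noteq> 0 \<Longrightarrow> \<iota> (padic_of_int p n) \<noteq> \<zero>\<^bsub>K\<^esub>"
  using \<iota>_zero \<iota>_inj padic_of_int_closed padic_of_int_eq_iff[OF prime_ge_2_nat[OF p]]
  by (metis inj_onD)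

lemma \<iota>_of_nat: "\<iota> (padic_of_int p (int n)) = [n] \<cdot>\<^bsub>K\<^esub> \<one>\<^bsub>K\<^esub>"
proof (induction n)
  case 0
  then show ?case by (simp add: \<iota>_zero)
next
  case (Suc n)
  have "\<iota> (padic_of_int p (int n + 1)) = \<iota> (padic_of_int p (int n)) \<oplus>\<^bsub>K\<^esub> \<one>\<^bsub>K\<^esub>"
    using ring_hom_add[OF \<iota>_int_hom, of "int n" 1] ring_hom_one[OF \<iota>_int_hom] by simp
  then show ?case using Suc by (simp add: add.commute K.add.nat_pow_Suc)
qed

lemma char_zero: "n \<noteq> 0 \<Longrightarrow> [n] \<cdot>\<^bsub>K\<^esub> \<one>\<^bsub>K\<^esub> \<noteq> \<zero>\<^bsub>K\<^esub>" for n :: nat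
  using \<iota>_int_nonzero[of "int n"] by (simp add: \<iota>_of_nat)

text \<open>The \<open>p\<close>-adic number \<open>1 + p d\<close> is nonzero already modulo \<open>p\<close>.\<close>

lemma padic_one_plus_p_mult:
  assumes d: "d \<in> carrier A"
  shows "\<one>\<^bsub>A\<^esub> \<oplus>\<^bsub>A\<^esub> padic_of_int p (int p) \<otimes>\<^bsub>A\<^esub> d \<noteq> padic_of_int p 0"
proof
  assume *: "\<one>\<^bsub>A\<^esub> \<oplus>\<^bsub>A\<^esub> padic_of_int p (int p) \<otimes>\<^bsub>A\<^esub> d = padic_of_int p 0"
  have "\<exists>m. 1 + int p * m \<in> ideal_pow \<Z> (PIdl\<^bsub>\<Z>\<^esub> (int p)) n" for n
  proof -
    define J where "J = ideal_pow \<Z> (PIdl\<^bsub>\<Z>\<^esub> (int p)) n"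
    interpret J: ideal J \<Z> unfolding J_def by (rule ideal_pow_ideal[OF int_is_cring PIdl_p])
    have "(\<one>\<^bsub>A\<^esub> \<oplus>\<^bsub>A\<^esub> padic_of_int p (int p) \<otimes>\<^bsub>A\<^esub> d) n
        = \<one>\<^bsub>\<Z> Quot J\<^esub> \<oplus>\<^bsub>\<Z> Quot J\<^esub> (J +>\<^bsub>\<Z>\<^esub> int p) \<otimes>\<^bsub>\<Z> Quot J\<^esub> d n"
      by (simp add: A_def padic_integers_def adic_completion_def adic_map_def J_def)
    then have eq: "\<one>\<^bsub>\<Z> Quot J\<^esub> \<oplus>\<^bsub>\<Z> Quot J\<^esub> (J +>\<^bsub>\<Z>\<^esub> int p) \<otimes>\<^bsub>\<Z> Quot J\<^esub> d n = J +>\<^bsub>\<Z>\<^esub> 0"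
      unfolding * by (simp add: adic_map_def J_def)
    have "d n \<in> carrier (\<Z> Quot J)"
      using d by (simp add: A_def padic_integers_def adic_completion_def J_def)
    then obtain m where m: "d n = J +>\<^bsub>\<Z>\<^esub> m"
      by (auto simp: FactRing_def A_RCOSETS_def')
    note hom = J.rcos_ring_hom
    have "J +>\<^bsub>\<Z>\<^esub> (1 + int p * m) = J +>\<^bsub>\<Z>\<^esub> 0"
      using eq ring_hom_add[OF hom, of 1 "int p * m"] ring_hom_mult[OF hom, of "int p" m]
        ring_hom_one[OF hom] by (simp add: m)
    moreover have "0 \<in> J" using J.zero_closed by simp
    ultimately have "1 + int p * m \<in> J +>\<^bsub>\<Z>\<^esub> 0" by (force simp: a_r_coset_def')
    then show ?thesis unfolding J_def[symmetric] by (auto simp: a_r_coset_def')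
  qed
  \<comment> \<open>Exponent one: modulo the zeroth power, which is the unit ideal, everything vanishes.\<close>
  from this[of 1] obtain m where "1 + int p * m \<in> ideal_pow \<Z> (PIdl\<^bsub>\<Z>\<^esub> (int p)) 1" by blast
  then have "int p ^ 1 dvd 1 + int p * m" using ideal_pow_int_subset by blast
  then have "int p dvd 1" by (simp add: dvd_add_left_iff)
  then show False using p not_prime_unit by fastforce
qed

text \<open>Clearing denominators in the value of a polynomial with \<open>p\<close>-adic integer coefficients at \<open>1/p\<close>: for
  \<open>n\<close> coefficients the degree is less than \<open>n\<close>, so multiplying by \<open>p\<^sup>n\<close> leaves a spare factor \<open>p\<close>.\<close>

lemma eval_at_inv_p:
  assumes "set q \<subseteq> \<iota> ` carrier A" "u = \<iota> (padic_of_int p (int p))"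
  shows "\<exists>d\<in>carrier A. u [^]\<^bsub>K\<^esub> length q \<otimes>\<^bsub>K\<^esub> ring.eval K q (inv\<^bsub>K\<^esub> u) = u \<otimes>\<^bsub>K\<^esub> \<iota> d"
  using assms(1)
proof (induction q)
  have u: "u \<in> carrier K" "u \<noteq> \<zero>\<^bsub>K\<^esub>"
    using \<iota>_int_nonzero[of "int p"] p ring_hom_closed[OF \<iota>_int_hom] by (auto simp: assms(2))
  case Nil
  show ?case
    using u \<iota>_zero padic_of_int_closed[of 0] by (auto intro!: bexI[of _ "padic_of_int p 0"])
next
  have u: "u \<in> carrier K" "u \<noteq> \<zero>\<^bsub>K\<^esub>"
    using \<iota>_int_nonzero[of "int p"] p ring_hom_closed[OF \<iota>_int_hom] by (auto simp: assms(2))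
  then have inv: "u \<in> Units K" by (simp add: K.field_Units)
  case (Cons a q)
  let ?v = "inv\<^bsub>K\<^esub> u" and ?n = "length q"
  obtain d where d: "d \<in> carrier A" "u [^]\<^bsub>K\<^esub> ?n \<otimes>\<^bsub>K\<^esub> ring.eval K q ?v = u \<otimes>\<^bsub>K\<^esub> \<iota> d"
    using Cons by auto
  obtain a' where a: "a' \<in> carrier A" "a = \<iota> a'" using Cons.prems by auto
  have v: "?v \<in> carrier K" using inv by simp
  have carr: "a \<in> carrier K" "\<iota> d \<in> carrier K"
    using a d ring_hom_closed[OF \<iota>_hom] by auto
  have "set q \<subseteq> carrier K" using Cons.prems ring_hom_closed[OF \<iota>_hom] by auto
  then have q: "ring.eval K q ?v \<in> carrier K" using v K.eval_in_carrier by blast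
  have uv: "u [^]\<^bsub>K\<^esub> ?n \<otimes>\<^bsub>K\<^esub> ?v [^]\<^bsub>K\<^esub> ?n = \<one>\<^bsub>K\<^esub>"
    using inv v u by (simp flip: K.nat_pow_distrib)
  have "u [^]\<^bsub>K\<^esub> length (a # q) \<otimes>\<^bsub>K\<^esub> ring.eval K (a # q) ?v
      = u \<otimes>\<^bsub>K\<^esub> (a \<otimes>\<^bsub>K\<^esub> (u [^]\<^bsub>K\<^esub> ?n \<otimes>\<^bsub>K\<^esub> ?v [^]\<^bsub>K\<^esub> ?n) \<oplus>\<^bsub>K\<^esub> u [^]\<^bsub>K\<^esub> ?n \<otimes>\<^bsub>K\<^esub> ring.eval K q ?v)"
    using u v carr q by (simp add: K.r_distr K.m_ac)
  also have "\<dots> = u \<otimes>\<^bsub>K\<^esub> (a \<oplus>\<^bsub>K\<^esub> u \<otimes>\<^bsub>K\<^esub> \<iota> d)"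
    using carr by (simp add: uv d(2))
  also have "\<dots> = u \<otimes>\<^bsub>K\<^esub> \<iota> (a' \<oplus>\<^bsub>A\<^esub> padic_of_int p (int p) \<otimes>\<^bsub>A\<^esub> d)"
    using a d padic_of_int_closed padic_closed
    by (simp add: ring_hom_add[OF \<iota>_hom] ring_hom_mult[OF \<iota>_hom] assms(2))
  finally show ?case using a d padic_of_int_closed padic_closed by blast
qed

text \<open>If a monic polynomial with \<open>p\<close>-adic integer coefficients vanished at \<open>1/p\<close>, clearing denominators
  would give \<open>1 + p d = 0\<close> with a \<open>p\<close>-adic integer \<open>d\<close>.\<close>

lemma inv_p_not_integral:
  "inv\<^bsub>K\<^esub> ([p] \<cdot>\<^bsub>K\<^esub> \<one>\<^bsub>K\<^esub>) \<notin> carrier (ring_of_integers p K \<iota>)"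
proof
  let ?u = "[p] \<cdot>\<^bsub>K\<^esub> \<one>\<^bsub>K\<^esub>"
  have u: "?u = \<iota> (padic_of_int p (int p))" by (simp add: \<iota>_of_nat)
  have "?u \<noteq> \<zero>\<^bsub>K\<^esub>" using char_zero[of p] p by auto
  then have unit: "?u \<in> Units K" by (simp add: K.field_Units)
  assume "inv\<^bsub>K\<^esub> ?u \<in> carrier (ring_of_integers p K \<iota>)"
  then obtain f where f: "polynomial\<^bsub>K\<^esub> (\<iota> ` carrier A) f" "f \<noteq> []" "lead_coeff f = \<one>\<^bsub>K\<^esub>"
    "ring.eval K f (inv\<^bsub>K\<^esub> ?u) = \<zero>\<^bsub>K\<^esub>"
    by (auto simp: ring_of_integers_def integral_closure_def A_def)
  then obtain q where q: "f = \<one>\<^bsub>K\<^esub> # q" by (cases f) auto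
  have set_q: "set q \<subseteq> \<iota> ` carrier A" using f(1) by (auto simp: q polynomial_def)
  let ?v = "inv\<^bsub>K\<^esub> ?u" and ?n = "length q"
  obtain d where d: "d \<in> carrier A" "?u [^]\<^bsub>K\<^esub> ?n \<otimes>\<^bsub>K\<^esub> ring.eval K q ?v = ?u \<otimes>\<^bsub>K\<^esub> \<iota> d"
    using eval_at_inv_p[OF set_q u] by blast
  have v: "?v \<in> carrier K" using unit by simp
  have oneA: "\<one>\<^bsub>A\<^esub> \<in> carrier A"
    using padic_of_int_closed[of 1] ring_hom_one[OF padic_of_int_hom] by simp
  have "set q \<subseteq> carrier K" using set_q ring_hom_closed[OF \<iota>_hom] by auto
  then have qv: "ring.eval K q ?v \<in> carrier K" using v K.eval_in_carrier by blast
  have uv: "?u [^]\<^bsub>K\<^esub> ?n \<otimes>\<^bsub>K\<^esub> ?v [^]\<^bsub>K\<^esub> ?n = \<one>\<^bsub>K\<^esub>"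
    using unit v by (simp flip: K.nat_pow_distrib)
  have "\<zero>\<^bsub>K\<^esub> = ?u [^]\<^bsub>K\<^esub> ?n \<otimes>\<^bsub>K\<^esub> (?v [^]\<^bsub>K\<^esub> ?n \<oplus>\<^bsub>K\<^esub> ring.eval K q ?v)"
    using f(4) v qv by (simp add: q)
  also have "\<dots> = \<one>\<^bsub>K\<^esub> \<oplus>\<^bsub>K\<^esub> ?u \<otimes>\<^bsub>K\<^esub> \<iota> d"
    using v qv by (simp add: K.r_distr uv d(2))
  also have "\<dots> = \<iota> (\<one>\<^bsub>A\<^esub> \<oplus>\<^bsub>A\<^esub> padic_of_int p (int p) \<otimes>\<^bsub>A\<^esub> d)"
    using d oneA padic_of_int_closed padic_closed
    by (simp add: ring_hom_add[OF \<iota>_hom] ring_hom_mult[OF \<iota>_hom] ring_hom_one[OF \<iota>_hom] u)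
  finally have "\<iota> (\<one>\<^bsub>A\<^esub> \<oplus>\<^bsub>A\<^esub> padic_of_int p (int p) \<otimes>\<^bsub>A\<^esub> d) = \<iota> (padic_of_int p 0)"
    by (simp add: \<iota>_zero)
  then have "\<one>\<^bsub>A\<^esub> \<oplus>\<^bsub>A\<^esub> padic_of_int p (int p) \<otimes>\<^bsub>A\<^esub> d = padic_of_int p 0"
    using \<iota>_inj d oneA padic_of_int_closed padic_closed by (meson inj_onD)
  then show False using padic_one_plus_p_mult[OF d(1)] by blast
qed

lemma ring_of_integers_simps:
  "zero (ring_of_integers p K \<iota>) = \<zero>\<^bsub>K\<^esub>" "one (ring_of_integers p K \<iota>) = \<one>\<^bsub>K\<^esub>"
  "mult (ring_of_integers p K \<iota>) = mult K" "add (ring_of_integers p K \<iota>) = add K"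
  "carrier (ring_of_integers p K \<iota>) \<subseteq> carrier K"
  by (auto simp: ring_of_integers_def integral_closure_def)

lemma ring_of_integers_of_nat:
  "[n] \<cdot>\<^bsub>ring_of_integers p K \<iota>\<^esub> \<one>\<^bsub>ring_of_integers p K \<iota>\<^esub> = [n] \<cdot>\<^bsub>K\<^esub> \<one>\<^bsub>K\<^esub>" for n :: nat
  by (induction n) (simp_all add: add_pow_def nat_pow_def ring_of_integers_simps)

lemma ring_of_integers_char_zero:
  "n \<noteq> 0 \<Longrightarrow> [n] \<cdot>\<^bsub>ring_of_integers p K \<iota>\<^esub> \<one>\<^bsub>ring_of_integers p K \<iota>\<^esub>
      \<noteq> \<zero>\<^bsub>ring_of_integers p K \<iota>\<^esub>" for n :: nat
  unfolding ring_of_integers_of_nat using char_zero by (simp add: ring_of_integers_simps)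

lemma ring_of_integers_domain:
  assumes "cring (ring_of_integers p K \<iota>)"
  shows "domain (ring_of_integers p K \<iota>)"
proof (rule domain.intro[OF assms], unfold_locales)
  show "\<one>\<^bsub>ring_of_integers p K \<iota>\<^esub> \<noteq> \<zero>\<^bsub>ring_of_integers p K \<iota>\<^esub>"
    by (simp add: ring_of_integers_simps)
next
  fix a b
  assume "a \<otimes>\<^bsub>ring_of_integers p K \<iota>\<^esub> b = \<zero>\<^bsub>ring_of_integers p K \<iota>\<^esub>"
    "a \<in> carrier (ring_of_integers p K \<iota>)" "b \<in> carrier (ring_of_integers p K \<iota>)"
  then show "a = \<zero>\<^bsub>ring_of_integers p K \<iota>\<^esub> \<or> b = \<zero>\<^bsub>ring_of_integers p K \<iota>\<^esub>"
    using subsetD[OF ring_of_integers_simps(5)] K.integral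
    unfolding ring_of_integers_simps by blast
qed

lemma ring_of_integers_not_field: "\<not> field (ring_of_integers p K \<iota>)"
proof
  let ?O = "ring_of_integers p K \<iota>"
  assume "field ?O"
  then interpret O: field ?O .
  let ?u = "add_pow ?O p \<one>\<^bsub>?O\<^esub>"
  have "?u \<noteq> \<zero>\<^bsub>?O\<^esub>"
    using ring_of_integers_char_zero[of p] p by auto
  then have "?u \<in> Units ?O" by (simp add: O.field_Units)
  then obtain y where y: "y \<in> carrier ?O" "?u \<otimes>\<^bsub>?O\<^esub> y = \<one>\<^bsub>?O\<^esub>"
    using O.Units_r_inv_ex by blast
  then have "inv\<^bsub>K\<^esub> ?u = y"
    using subsetD[OF ring_of_integers_simps(5)]
    by (intro K.comm_inv_char) (simp_all add: ring_of_integers_of_nat, simp add: ring_of_integers_simps)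
  then show False using y(1) inv_p_not_integral by (simp add: ring_of_integers_of_nat)
qed

text \<open>In a field the zero ideal is maximal, so the definition of a uniformizer alone does not exclude
  zero. For a field \<open>k\<close> in place of the ring of integers and \<open>\<pi> = x\<close>, the first assertion of the
  theorem below would fail for the map from \<open>k[[x]]\<close> to \<open>k\<close> sending \<open>x\<close> to \<open>0\<close>.\<close>

lemma uniformizer_nonzero:
  assumes "cring (ring_of_integers p K \<iota>)" "uniformizer (ring_of_integers p K \<iota>) varpi"
  shows "varpi \<noteq> \<zero>\<^bsub>ring_of_integers p K \<iota>\<^esub>"
proof
  let ?O = "ring_of_integers p K \<iota>"
  interpret O: cring ?O by fact
  assume "varpi = \<zero>\<^bsub>?O\<^esub>"
  moreover have "PIdl\<^bsub>?O\<^esub> \<zero>\<^bsub>?O\<^esub> = {\<zero>\<^bsub>?O\<^esub>}"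
    unfolding cgenideal_def using O.zero_closed by (auto intro!: exI[of _ "\<zero>\<^bsub>?O\<^esub>"])
  ultimately have "maximalideal {\<zero>\<^bsub>?O\<^esub>} ?O"
    using assms(2) by (simp add: uniformizer_def)
  then show False using O.zeromaximalideal_fieldI ring_of_integers_not_field by blast
qed

end

section \<open>Free modules and quotient rings\<close>

text \<open>Compare the coordinates of \<open>a x\<close> with those of zero.\<close>

lemma smult_nonzerodivisor_on_free_module:
  assumes free: "finite_free_module A M"
    and a: "a \<in> carrier A" "\<And>c. c \<in> carrier A \<Longrightarrow> a \<otimes>\<^bsub>A\<^esub> c = \<zero>\<^bsub>A\<^esub> \<Longrightarrow> c = \<zero>\<^bsub>A\<^esub>"
    and x: "x \<in> carrier M" "a \<odot>\<^bsub>M\<^esub> x = \<zero>\<^bsub>M\<^esub>"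
  shows "x = \<zero>\<^bsub>M\<^esub>"
proof -
  interpret module A M using free by (simp add: finite_free_module_def)
  obtain n :: nat and b where b: "b \<in> {..<n} \<rightarrow> carrier M"
    and basis: "\<And>x. x \<in> carrier M \<Longrightarrow> \<exists>!c. c \<in> {..<n} \<rightarrow>\<^sub>E carrier A \<and>
         x = (\<Oplus>\<^bsub>M\<^esub>i\<in>{..<n}. c i \<odot>\<^bsub>M\<^esub> b i)"
    using free by (auto simp: finite_free_module_def)
  define comb where "comb = (\<lambda>c. \<Oplus>\<^bsub>M\<^esub>i\<in>{..<n}. c i \<odot>\<^bsub>M\<^esub> b i)"
  obtain c where c: "c \<in> {..<n} \<rightarrow>\<^sub>E carrier A" "x = comb c"
    using basis[OF x(1)] by (auto simp: comb_def)
  define z where "z = (\<lambda>i\<in>{..<n}. \<zero>\<^bsub>A\<^esub>)"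
  define d where "d = (\<lambda>i\<in>{..<n}. a \<otimes>\<^bsub>A\<^esub> c i)"
  have ci: "c i \<in> carrier A" "b i \<in> carrier M" if "i < n" for i
    using c(1) b that by auto
  have "comb d = (\<Oplus>\<^bsub>M\<^esub>i\<in>{..<n}. a \<odot>\<^bsub>M\<^esub> (c i \<odot>\<^bsub>M\<^esub> b i))"
    unfolding comb_def d_def using a ci
    by (intro M.add.finprod_cong) (auto simp: smult_assoc1 simp_implies_def)
  also have "\<dots> = a \<odot>\<^bsub>M\<^esub> comb c"
    unfolding comb_def using a ci by (subst finsum_smult_ldistr) auto
  finally have d: "comb d = \<zero>\<^bsub>M\<^esub>" using x(2) c(2) by simp
  have z: "comb z = \<zero>\<^bsub>M\<^esub>"
    unfolding comb_def z_def using ci by (subst M.add.finprod_one_eqI) auto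
  have "d \<in> {..<n} \<rightarrow>\<^sub>E carrier A" "z \<in> {..<n} \<rightarrow>\<^sub>E carrier A"
    using ci a by (auto simp: d_def z_def)
  then have "d = z" using basis[OF M.zero_closed] d z unfolding comb_def by metis
  then have "c i = \<zero>\<^bsub>A\<^esub>" if "i < n" for i
    using that a(2) ci(1)[OF that] by (auto simp: d_def z_def dest: fun_cong[of _ _ i])
  then have "c i = z i" for i
    using PiE_arb[OF c(1), of i] by (cases "i < n") (simp_all add: z_def)
  then have "c = z" by blast
  then show ?thesis using z c(2) by simp
qed

context
  fixes R (structure) and I
  assumes R: "ring R" and I: "ideal I R"
begin

interpretation ideal I R by (rule I)

lemma coset_eq_ideal_iff: "x \<in> carrier R \<Longrightarrow> I +> x = I \<longleftrightarrow> x \<in> I"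
  using a_rcos_const a_coset_join1 a_subgroup by blast

lemma coset_in_quotient: "x \<in> carrier R \<Longrightarrow> I +> x \<in> carrier (R Quot I)"
  using ring_hom_closed[OF rcos_ring_hom] by blast

lemma ideal_proper_if_quotient_maps_to_nontrivial:
  assumes h: "h \<in> ring_hom (R Quot I) B" and B: "ring B" "\<one>\<^bsub>B\<^esub> \<noteq> \<zero>\<^bsub>B\<^esub>"
  shows "I \<noteq> carrier R"
proof
  assume "I = carrier R"
  then have "\<one>\<^bsub>R Quot I\<^esub> = \<zero>\<^bsub>R Quot I\<^esub>"
    using coset_eq_ideal_iff[of \<one>] by (simp add: FactRing_def)
  then show False
    using ring_hom_one[OF h] ring_hom_zero[OF h quotient_is_ring B(1)] B(2) by simp
qed

end

text \<open>The map on quotients is defined by choosing the unique element of an image; under these hypotheses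
  the image is indeed a singleton.\<close>

lemma quot_map_coset:
  assumes "ring_hom_ring R S f" "ideal I R" "ideal J S" "f ` I \<subseteq> J" "x \<in> carrier R"
  shows "quot_map S J f (I +>\<^bsub>R\<^esub> x) = J +>\<^bsub>S\<^esub> f x"
proof -
  interpret ring_hom_ring R S f by fact
  interpret I: ideal I R by fact
  interpret J: ideal J S by fact
  have "J +>\<^bsub>S\<^esub> f y = J +>\<^bsub>S\<^esub> f x" if y: "y \<in> I +>\<^bsub>R\<^esub> x" for y
  proof -
    obtain i where "i \<in> I" "y = i \<oplus>\<^bsub>R\<^esub> x" using y by (auto simp: a_r_coset_def')
    then have "f y = f i \<oplus>\<^bsub>S\<^esub> f x" "f i \<in> J" using assms(4,5) by auto
    then have "f y \<in> J +>\<^bsub>S\<^esub> f x" by (auto simp: a_r_coset_def')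
    then show ?thesis using J.a_repr_independence' assms(5) by auto
  qed
  moreover have "x \<in> I +>\<^bsub>R\<^esub> x" using assms(5) by (rule I.a_rcos_self)
  ultimately have "(\<lambda>y. J +>\<^bsub>S\<^esub> f y) ` (I +>\<^bsub>R\<^esub> x) = {J +>\<^bsub>S\<^esub> f x}" by blast
  then show ?thesis by (simp add: quot_map_def)
qed

lemma carrier_principal_subquotient:
  "carrier (principal_subquotient R a)
    = (\<lambda>x. PIdl\<^bsub>R\<^esub> (a [^]\<^bsub>R\<^esub> (2::nat)) +>\<^bsub>R\<^esub> x) ` (PIdl\<^bsub>R\<^esub> a)"
  by (auto simp: principal_subquotient_def A_FactGroup_def FactGroup_def RCOSETS_def
      a_r_coset_def r_coset_def)

text \<open>Pigeonhole principle: two of the infinitely many multiples of \<open>a\<close> lie in the same coset of \<open>a\<^sup>2S\<close>, and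
  their difference is a positive multiple of \<open>a\<close>.\<close>

lemma finite_principal_subquotient_killed:
  fixes S (structure)
  assumes "cring S" "a \<in> carrier S" "finite (carrier (principal_subquotient S a))"
  shows "\<exists>n::nat. n \<noteq> 0 \<and> add_pow S n a \<in> PIdl (a [^] (2::nat))"
proof -
  interpret cring S by fact
  let ?J = "PIdl (a [^] (2::nat))"
  interpret J: ideal ?J S using assms(2) by (intro cgenideal_ideal) simp
  interpret I: ideal "PIdl a" S using assms(2) by (rule cgenideal_ideal)
  have mem: "add_pow S n a \<in> PIdl a" for n :: nat
    by (induction n) (simp_all add: cgenideal_self[OF assms(2)] add.nat_pow_Suc)
  have "range (\<lambda>n::nat. ?J +> add_pow S n a) \<subseteq> carrier (principal_subquotient S a)"
    using mem by (auto simp: carrier_principal_subquotient)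
  then have "finite (range (\<lambda>n::nat. ?J +> add_pow S n a))"
    using assms(3) finite_subset by blast
  then have "\<not> inj (\<lambda>n::nat. ?J +> add_pow S n a)"
    using finite_imageD infinite_UNIV_nat by blast
  then obtain m n :: nat where mn: "m < n" "?J +> add_pow S m a = ?J +> add_pow S n a"
    unfolding inj_def by (metis linorder_neqE_nat)
  have split: "add_pow S n a = add_pow S (n - m) a \<oplus> add_pow S m a"
    using mn(1) assms(2) by (simp add: add.nat_pow_mult)
  have "add_pow S n a \<in> ?J +> add_pow S m a"
    using mn(2) J.a_rcos_self[of "add_pow S n a"] assms(2) by simp
  then obtain j where j: "j \<in> ?J" "add_pow S n a = j \<oplus> add_pow S m a"
    by (auto simp: a_r_coset_def')
  then have "add_pow S (n - m) a = j" using split assms(2) by simp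
  then show ?thesis using j(1) mn(1) by (intro exI[of _ "n - m"]) auto
qed

lemma FactRing_regular_algebra: "regular_algebra A Quot I = A Quot I"
  by (simp add: FactRing_def regular_algebra_def A_RCOSETS_def' a_r_coset_def' rcoset_mult_def
      set_add_def' fun_eq_iff)

lemma ring_hom_quotient_algebra:
  "ring_hom (quotient_algebra R I) B = ring_hom (R Quot I) B"
  "ring_hom B (quotient_algebra R I) = ring_hom B (R Quot I)"
  by (simp_all add: ring_hom_def quotient_algebra_def)

lemma ring_hom_regular_algebra: "ring_hom B (regular_algebra A) = ring_hom B A"
  by (simp add: ring_hom_def regular_algebra_def)

text \<open>An isomorphism of algebras preserves annihilators: \<open>a\<close> kills \<open>A/J\<close>, hence also \<open>R/I\<close>.\<close>

lemma smult_one_in_ideal_if_quotient_iso: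
  assumes R: "algebra A R" "ideal I R" and J: "ideal J A" and a: "a \<in> J"
    and h: "h \<in> algebra_iso A (quotient_algebra R I) (quotient_algebra (regular_algebra A) J)"
  shows "a \<odot>\<^bsub>R\<^esub> \<one>\<^bsub>R\<^esub> \<in> I"
proof -
  interpret algebra A R by fact
  interpret I: ideal I R by fact
  interpret J: ideal J A by fact
  note quots = I.quotient_is_ring J.quotient_is_ring
  have hom: "h \<in> ring_hom (R Quot I) (A Quot J)"
    using h by (simp add: algebra_iso_def algebra_hom_def ring_hom_quotient_algebra)
      (simp add: ring_hom_def quotient_algebra_def FactRing_regular_algebra)
  have inj: "inj_on h (carrier (R Quot I))"
    using h by (simp add: algebra_iso_def bij_betw_def quotient_algebra_def)
  have aA: "a \<in> carrier A" using a by simp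
  let ?e = "I +>\<^bsub>R\<^esub> \<one>\<^bsub>R\<^esub>" and ?s = "a \<odot>\<^bsub>R\<^esub> \<one>\<^bsub>R\<^esub>"
  have e: "?e = \<one>\<^bsub>R Quot I\<^esub>" by (simp add: FactRing_def)
  have s: "?s \<in> carrier R" using aA by simp
  have "I +>\<^bsub>R\<^esub> (a \<odot>\<^bsub>R\<^esub> x) = I +>\<^bsub>R\<^esub> ?s" if x: "x \<in> ?e" for x
  proof -
    obtain i where i: "i \<in> I" "x = i \<oplus>\<^bsub>R\<^esub> \<one>\<^bsub>R\<^esub>" using x by (auto simp: a_r_coset_def')
    have "a \<odot>\<^bsub>R\<^esub> i = ?s \<otimes>\<^bsub>R\<^esub> i" using aA i by (simp add: smult_assoc2)
    then have "a \<odot>\<^bsub>R\<^esub> i \<in> I" using I.I_l_closed[OF i(1) s] by simp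
    moreover have "a \<odot>\<^bsub>R\<^esub> x = a \<odot>\<^bsub>R\<^esub> i \<oplus>\<^bsub>R\<^esub> ?s" using aA i by (simp add: smult_r_distr)
    ultimately have "a \<odot>\<^bsub>R\<^esub> x \<in> I +>\<^bsub>R\<^esub> ?s" by (auto simp: a_r_coset_def')
    then show ?thesis using I.a_repr_independence' s by auto
  qed
  moreover have "\<one>\<^bsub>R\<^esub> \<in> ?e" by (rule I.a_rcos_self) simp
  ultimately have "(\<Union>x\<in>?e. I +>\<^bsub>R\<^esub> (a \<odot>\<^bsub>R\<^esub> x)) = I +>\<^bsub>R\<^esub> ?s" by blast
  then have left: "a \<odot>\<^bsub>quotient_algebra R I\<^esub> ?e = I +>\<^bsub>R\<^esub> ?s"
    by (simp add: quotient_algebra_def)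
  have "J +>\<^bsub>A\<^esub> (a \<otimes>\<^bsub>A\<^esub> x) = J" if "x \<in> J +>\<^bsub>A\<^esub> \<one>\<^bsub>A\<^esub>" for x
    using J.a_rcos_const[OF J.I_r_closed[OF a J.a_elemrcos_carrier[OF R.one_closed that]]] .
  moreover have "\<one>\<^bsub>A\<^esub> \<in> J +>\<^bsub>A\<^esub> \<one>\<^bsub>A\<^esub>" by (rule J.a_rcos_self[OF R.one_closed])
  ultimately have "(\<Union>x\<in>J +>\<^bsub>A\<^esub> \<one>\<^bsub>A\<^esub>. J +>\<^bsub>A\<^esub> (a \<otimes>\<^bsub>A\<^esub> x)) = J" by blast
  then have right: "a \<odot>\<^bsub>quotient_algebra (regular_algebra A) J\<^esub> (J +>\<^bsub>A\<^esub> \<one>\<^bsub>A\<^esub>) = J"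
    by (simp add: quotient_algebra_def regular_algebra_def a_r_coset_def')
  have "h (a \<odot>\<^bsub>quotient_algebra R I\<^esub> ?e)
      = a \<odot>\<^bsub>quotient_algebra (regular_algebra A) J\<^esub> h ?e"
    using h aA coset_in_quotient[OF ideal.axioms(2)[OF R(2)] R(2), of "\<one>\<^bsub>R\<^esub>"]
    by (simp add: algebra_iso_def algebra_hom_def quotient_algebra_def)
  also have "h ?e = J +>\<^bsub>A\<^esub> \<one>\<^bsub>A\<^esub>"
    using ring_hom_one[OF hom] by (simp add: FactRing_def)
  finally have "h (I +>\<^bsub>R\<^esub> ?s) = h I"
    using left right ring_hom_zero[OF hom quots] by (simp add: FactRing_def)
  moreover have "I \<in> carrier (R Quot I)"
    using ring.ring_simprules(2)[OF quots(1)] by (simp add: FactRing_def)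
  ultimately have "I +>\<^bsub>R\<^esub> ?s = I"
    using inj coset_in_quotient[OF ideal.axioms(2)[OF R(2)] R(2) s] by (meson inj_onD)
  then show ?thesis using coset_eq_ideal_iff[OF ideal.axioms(2)[OF R(2)] R(2) s] by simp
qed

section \<open>Vanishing of the kernel\<close>

text \<open>The kernel \<open>N\<close> of \<open>f\<close> satisfies \<open>N = N a\<close>, and \<open>a\<close> lies in the maximal ideal of \<open>R\<close>.\<close>

lemma inj_if_kernel_divisible:
  assumes R: "local_ring R" "noetherian_ring R" "adically_complete R (max_ideal R)"
    and f: "ring_hom_ring R S f" and a: "a \<in> carrier R" "PIdl\<^bsub>R\<^esub> a \<noteq> carrier R"
    and div: "\<And>x. x \<in> carrier R \<Longrightarrow> f x = \<zero>\<^bsub>S\<^esub> \<Longrightarrow> \<exists>y\<in>carrier R. x = y \<otimes>\<^bsub>R\<^esub> a \<and> f y = \<zero>\<^bsub>S\<^esub>"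
  shows "inj_on f (carrier R)"
proof -
  interpret ring_hom_ring R S f by fact
  have cring: "cring R" using R(1) by (simp add: local_ring_def)
  have ideal: "ideal (max_ideal R) R"
    using max_ideal_maximal[OF R(1)] by (rule maximalideal.axioms)
  have "a_kernel R S f \<subseteq> {\<zero>\<^bsub>R\<^esub>}"
  proof (rule divisible_subset_trivial[OF cring ideal R(3)])
    show "a_kernel R S f \<subseteq> carrier R" unfolding a_kernel_def' by blast
    show "a \<in> max_ideal R" by (rule nonunit_in_max_ideal[OF R(1,2) a])
    fix x assume "x \<in> a_kernel R S f"
    then show "\<exists>y\<in>a_kernel R S f. x = y \<otimes>\<^bsub>R\<^esub> a"
      using div[of x] unfolding a_kernel_def' by blast
  qed
  moreover have "\<zero>\<^bsub>R\<^esub> \<in> a_kernel R S f" unfolding a_kernel_def' by simp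
  ultimately show ?thesis by (intro trivial_ker_imp_inj) blast
qed

text \<open>A nonzerodivisor \<open>c\<close> among the multiples of \<open>f a\<close> makes \<open>f a\<close> itself a nonzerodivisor. If \<open>x = y a\<close> is in the
  kernel, then \<open>f y \<cdot> f a = 0\<close>, so \<open>y\<close> is in the kernel.\<close>

lemma inj_if_nonzerodivisor_in_ideal:
  assumes R: "local_ring R" "noetherian_ring R" "adically_complete R (max_ideal R)"
    and S: "cring S" "noetherian_ring S"
    and f: "ring_hom_ring R S f" and a: "a \<in> carrier R" "PIdl\<^bsub>R\<^esub> a \<noteq> carrier R"
    and ker: "\<And>x. x \<in> carrier R \<Longrightarrow> f x = \<zero>\<^bsub>S\<^esub> \<Longrightarrow> x \<in> PIdl\<^bsub>R\<^esub> a"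
    and c: "c \<in> PIdl\<^bsub>S\<^esub> (f a)" "\<And>x. x \<in> carrier S \<Longrightarrow> c \<otimes>\<^bsub>S\<^esub> x = \<zero>\<^bsub>S\<^esub> \<Longrightarrow> x = \<zero>\<^bsub>S\<^esub>"
  shows "inj_on f (carrier R)"
proof (rule inj_if_kernel_divisible[OF R f a])
  interpret ring_hom_ring R S f by fact
  interpret S: cring S by fact
  fix x assume x: "x \<in> carrier R" "f x = \<zero>\<^bsub>S\<^esub>"
  obtain v where v: "v \<in> carrier S" "c = v \<otimes>\<^bsub>S\<^esub> f a"
    using c(1) by (auto simp: cgenideal_def)
  obtain y where y: "y \<in> carrier R" "x = y \<otimes>\<^bsub>R\<^esub> a"
    using ker[OF x] by (auto simp: cgenideal_def)
  have "f y = \<zero>\<^bsub>S\<^esub>"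
  proof (rule inj_mult_if_cokernel_killed[OF S subset_refl _ c(2)])
    show "c \<in> carrier S" "f a \<in> carrier S" "f y \<in> carrier S" using v a y by auto
    show "f a \<otimes>\<^bsub>S\<^esub> f y = \<zero>\<^bsub>S\<^esub>" using x a y by (simp add: S.m_comm)
    show "\<exists>z\<in>carrier S. c \<otimes>\<^bsub>S\<^esub> s = f a \<otimes>\<^bsub>S\<^esub> z" if "s \<in> carrier S" for s
      using that v a by (intro bexI[of _ "v \<otimes>\<^bsub>S\<^esub> s"]) (auto simp: S.m_ac)
  qed
  then show "\<exists>y\<in>carrier R. x = y \<otimes>\<^bsub>R\<^esub> a \<and> f y = \<zero>\<^bsub>S\<^esub>" using y by blast
qed

text \<open>Here \<open>t = f a\<close> may be a zero divisor, but a nonzerodivisor \<open>c\<close> kills \<open>tS/t\<^sup>2S\<close>, so multiplication by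
  \<open>t\<close> is injective on \<open>tS\<close>. If \<open>x = y a\<^sup>2\<close> is in the kernel, then \<open>t (f y \<cdot> t) = 0\<close>, hence \<open>f y \<cdot> t = 0\<close>.
  Thus \<open>x = (y a) a\<close>, with \<open>y a\<close> in the kernel.\<close>

lemma inj_if_nonzerodivisor_kills_subquotient:
  assumes R: "local_ring R" "noetherian_ring R" "adically_complete R (max_ideal R)"
    and S: "cring S" "noetherian_ring S"
    and f: "ring_hom_ring R S f" and a: "a \<in> carrier R" "PIdl\<^bsub>R\<^esub> a \<noteq> carrier R"
    and ker: "\<And>x. x \<in> carrier R \<Longrightarrow> f x = \<zero>\<^bsub>S\<^esub> \<Longrightarrow> x \<in> PIdl\<^bsub>R\<^esub> (a [^]\<^bsub>R\<^esub> (2::nat))"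
    and c: "c \<in> carrier S" "\<And>x. x \<in> carrier S \<Longrightarrow> c \<otimes>\<^bsub>S\<^esub> x = \<zero>\<^bsub>S\<^esub> \<Longrightarrow> x = \<zero>\<^bsub>S\<^esub>"
      "c \<otimes>\<^bsub>S\<^esub> f a \<in> PIdl\<^bsub>S\<^esub> (f a [^]\<^bsub>S\<^esub> (2::nat))"
  shows "inj_on f (carrier R)"
proof (rule inj_if_kernel_divisible[OF R f a])
  interpret ring_hom_ring R S f by fact
  interpret R: cring R using R(1) by (simp add: local_ring_def)
  interpret S: cring S by fact
  have fa: "f a \<in> carrier S" using a by simp
  fix x assume x: "x \<in> carrier R" "f x = \<zero>\<^bsub>S\<^esub>"
  obtain v where v: "v \<in> carrier S" "c \<otimes>\<^bsub>S\<^esub> f a = v \<otimes>\<^bsub>S\<^esub> (f a \<otimes>\<^bsub>S\<^esub> f a)"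
    using c(3) fa by (auto simp: cgenideal_def numeral_2_eq_2)
  obtain y where y: "y \<in> carrier R" "x = y \<otimes>\<^bsub>R\<^esub> (a \<otimes>\<^bsub>R\<^esub> a)"
    using ker[OF x] a by (auto simp: cgenideal_def numeral_2_eq_2)
  have "f y \<otimes>\<^bsub>S\<^esub> f a = \<zero>\<^bsub>S\<^esub>"
  proof (rule inj_mult_if_cokernel_killed[OF S _ c(1,2) fa])
    show "PIdl\<^bsub>S\<^esub> (f a) \<subseteq> carrier S" using fa by (auto simp: cgenideal_def)
    show "f y \<otimes>\<^bsub>S\<^esub> f a \<in> PIdl\<^bsub>S\<^esub> (f a)" using y by (auto simp: cgenideal_def)
    show "f a \<otimes>\<^bsub>S\<^esub> (f y \<otimes>\<^bsub>S\<^esub> f a) = \<zero>\<^bsub>S\<^esub>" using x a y by (simp add: S.m_lcomm)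
    fix s assume "s \<in> PIdl\<^bsub>S\<^esub> (f a)"
    then obtain w where w: "w \<in> carrier S" "s = w \<otimes>\<^bsub>S\<^esub> f a" by (auto simp: cgenideal_def)
    have "c \<otimes>\<^bsub>S\<^esub> s = w \<otimes>\<^bsub>S\<^esub> (c \<otimes>\<^bsub>S\<^esub> f a)" using w c(1) fa by (simp add: S.m_lcomm)
    also have "\<dots> = f a \<otimes>\<^bsub>S\<^esub> (w \<otimes>\<^bsub>S\<^esub> v \<otimes>\<^bsub>S\<^esub> f a)"
      using w v(1) fa by (simp add: v(2) S.m_ac)
    finally show "\<exists>z\<in>PIdl\<^bsub>S\<^esub> (f a). c \<otimes>\<^bsub>S\<^esub> s = f a \<otimes>\<^bsub>S\<^esub> z"
      using w v by (intro bexI[of _ "w \<otimes>\<^bsub>S\<^esub> v \<otimes>\<^bsub>S\<^esub> f a"]) (auto simp: cgenideal_def)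
  qed
  then have "f (y \<otimes>\<^bsub>R\<^esub> a) = \<zero>\<^bsub>S\<^esub>" using y a by simp
  then show "\<exists>y\<in>carrier R. x = y \<otimes>\<^bsub>R\<^esub> a \<and> f y = \<zero>\<^bsub>S\<^esub>"
    using y a by (intro bexI[of _ "y \<otimes>\<^bsub>R\<^esub> a"]) (auto simp: R.m_assoc)
qed

theorem theorem7p1:
  fixes p :: nat
    and K :: "'k ring"
    and \<iota> :: "(nat \<Rightarrow> int set) \<Rightarrow> 'k"
    and \<O> :: "'k ring"
    and varpi :: 'k
    and R :: "('k, 'r) module"
    and S :: "('k, 's) module"
    and \<phi> :: "'r \<Rightarrow> 's"
    and \<pi> :: 'r
  assumes "Factorial_Ring.prime p"
    and "finite_padic_extension p K \<iota>"
    and "\<O> = ring_of_integers p K \<iota>"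
    and "uniformizer \<O> varpi"
    and "complete_local_noetherian_algebra \<O> (PIdl\<^bsub>\<O>\<^esub> varpi) R"
    and "complete_local_noetherian_algebra \<O> (PIdl\<^bsub>\<O>\<^esub> varpi) S"
    and "finite_free_module \<O> S"
    and "\<phi> \<in> algebra_hom \<O> R S"
    and "\<phi> ` carrier R = carrier S"
    and "identity_on_residue_fields \<O> (PIdl\<^bsub>\<O>\<^esub> varpi) R S \<phi>"
    and "\<pi> \<in> carrier R"
    and "\<forall>x\<in>carrier R. phi_n S \<phi> \<pi> 1 (PIdl\<^bsub>R\<^esub> \<pi> +>\<^bsub>R\<^esub> x) = PIdl\<^bsub>S\<^esub> (\<phi> \<pi>) +>\<^bsub>S\<^esub> \<phi> x"
    and "finite (carrier (principal_subquotient S (\<phi> \<pi>)))"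
    and "phi_n S \<phi> \<pi> 1 \<in> ring_iso (R Quot (PIdl\<^bsub>R\<^esub> \<pi>)) (S Quot (PIdl\<^bsub>S\<^esub> (\<phi> \<pi>)))"
  shows "((\<exists>r::nat. r > 0 \<and>
             algebra_iso \<O> (quotient_algebra R (PIdl\<^bsub>R\<^esub> \<pi>))
               (quotient_algebra (regular_algebra \<O>) (PIdl\<^bsub>\<O>\<^esub> (varpi [^]\<^bsub>\<O>\<^esub> r))) \<noteq> {})
           \<longrightarrow> \<phi> \<in> algebra_iso \<O> R S) \<and>
         (algebra_iso \<O> (quotient_algebra R (PIdl\<^bsub>R\<^esub> \<pi>)) (regular_algebra \<O>) \<noteq> {} \<and>
          phi_n S \<phi> \<pi> 2 \<in> iso (principal_subquotient R \<pi>) (principal_subquotient S (\<phi> \<pi>))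
           \<longrightarrow> \<phi> \<in> algebra_iso \<O> R S)"
proof -
  let ?P = "PIdl\<^bsub>R\<^esub> \<pi>" and ?T = "\<phi> \<pi>"
  let ?Q = "PIdl\<^bsub>S\<^esub> ?T"
  have R: "algebra \<O> R" "noetherian_ring R" "local_ring R" "adically_complete R (max_ideal R)"
    and S: "algebra \<O> S" "noetherian_ring S"
    using assms(5,6) by (simp_all add: complete_local_noetherian_algebra_def)
  interpret R: cring R by (rule algebra.axioms[OF R(1)])
  interpret S: cring S by (rule algebra.axioms[OF S(1)])
  have O: "cring \<O>" by (rule module.axioms(1)[OF algebra.axioms(1)[OF R(1)]])
  interpret O: domain \<O>
    using ring_of_integers_domain[OF assms(1,2)] O by (simp add: assms(3))
  interpret algR: algebra \<O> R by (rule R(1))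
  interpret algS: algebra \<O> S by (rule S(1))
  have \<phi>: "\<phi> \<in> ring_hom R S" "\<And>a x. a \<in> carrier \<O> \<Longrightarrow> x \<in> carrier R \<Longrightarrow> \<phi> (a \<odot>\<^bsub>R\<^esub> x) = a \<odot>\<^bsub>S\<^esub> \<phi> x"
    using assms(8) by (simp_all add: algebra_hom_def)
  interpret hom: ring_hom_ring R S \<phi>
    by (rule ring_hom_ringI2[OF R.ring_axioms S.ring_axioms \<phi>(1)])
  have \<pi>: "\<pi> \<in> carrier R" by (rule assms(11))
  have P: "ideal ?P R" by (rule R.cgenideal_ideal[OF \<pi>])
  have iso: "\<phi> \<in> algebra_iso \<O> R S" if "inj_on \<phi> (carrier R)"
    using that assms(8,9) by (simp add: algebra_iso_def bij_betw_def)
  have torsion_free: "x = \<zero>\<^bsub>S\<^esub>"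
    if "a \<in> carrier \<O>" "a \<noteq> \<zero>\<^bsub>\<O>\<^esub>" "x \<in> carrier S" "(a \<odot>\<^bsub>S\<^esub> \<one>\<^bsub>S\<^esub>) \<otimes>\<^bsub>S\<^esub> x = \<zero>\<^bsub>S\<^esub>" for a x
  proof (rule smult_nonzerodivisor_on_free_module[OF assms(7) that(1) _ that(3)])
    show "a \<odot>\<^bsub>S\<^esub> x = \<zero>\<^bsub>S\<^esub>" using that by (simp add: algS.smult_assoc2)
    show "c = \<zero>\<^bsub>\<O>\<^esub>" if "c \<in> carrier \<O>" "a \<otimes>\<^bsub>\<O>\<^esub> c = \<zero>\<^bsub>\<O>\<^esub>" for c
      using that O.integral \<open>a \<in> carrier \<O>\<close> \<open>a \<noteq> \<zero>\<^bsub>\<O>\<^esub>\<close> by blast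
  qed
  \<comment> \<open>Injectivity of \<open>\<phi>\<^sub>1\<close> on the coset of \<open>x\<close>, whose image is the zero coset.\<close>
  have ker1: "x \<in> ?P" if x: "x \<in> carrier R" "\<phi> x = \<zero>\<^bsub>S\<^esub>" for x
  proof -
    have "phi_n S \<phi> \<pi> 1 (?P +>\<^bsub>R\<^esub> x) = phi_n S \<phi> \<pi> 1 (?P +>\<^bsub>R\<^esub> \<zero>\<^bsub>R\<^esub>)"
      using assms(12) x by simp
    then have "?P +>\<^bsub>R\<^esub> x = ?P +>\<^bsub>R\<^esub> \<zero>\<^bsub>R\<^esub>"
      using assms(14) coset_in_quotient[OF R.ring_axioms P] x(1)
      by (auto simp: ring_iso_def bij_betw_def dest: inj_onD)
    also have "\<dots> = ?P"
      using coset_eq_ideal_iff[OF R.ring_axioms P] ideal.axioms(1)[OF P]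
        additive_subgroup.zero_closed by blast
    finally show ?thesis using coset_eq_ideal_iff[OF R.ring_axioms P x(1)] by simp
  qed
  show ?thesis
  proof (intro conjI impI)
    assume "\<exists>r::nat. r > 0 \<and>
             algebra_iso \<O> (quotient_algebra R ?P)
               (quotient_algebra (regular_algebra \<O>) (PIdl\<^bsub>\<O>\<^esub> (varpi [^]\<^bsub>\<O>\<^esub> r))) \<noteq> {}"
    then obtain r :: nat and h where r: "r > 0" and h: "h \<in> algebra_iso \<O> (quotient_algebra R ?P)
               (quotient_algebra (regular_algebra \<O>) (PIdl\<^bsub>\<O>\<^esub> (varpi [^]\<^bsub>\<O>\<^esub> r)))"
      by blast
    let ?a = "varpi [^]\<^bsub>\<O>\<^esub> r"
    let ?J = "PIdl\<^bsub>\<O>\<^esub> ?a"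
    have varpi: "varpi \<in> carrier \<O>" "maximalideal (PIdl\<^bsub>\<O>\<^esub> varpi) \<O>"
      using assms(4) by (simp_all add: uniformizer_def)
    have "varpi \<noteq> \<zero>\<^bsub>\<O>\<^esub>"
      using uniformizer_nonzero[OF assms(1,2)] O assms(4) by (simp add: assms(3))
    then have "varpi [^]\<^bsub>\<O>\<^esub> m \<noteq> \<zero>\<^bsub>\<O>\<^esub>" for m :: nat
      using varpi(1) by (induction m) (simp_all add: O.integral_iff)
    then have a: "?a \<in> carrier \<O>" "?a \<noteq> \<zero>\<^bsub>\<O>\<^esub>"
      using varpi(1) by simp_all
    have J: "ideal ?J \<O>" by (rule O.cgenideal_ideal[OF a(1)])
    interpret V: maximalideal "PIdl\<^bsub>\<O>\<^esub> varpi" \<O> by (rule varpi(2))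
    obtain k where k: "r = Suc k" using r gr0_implies_Suc by blast
    have "?a \<in> PIdl\<^bsub>\<O>\<^esub> varpi"
      unfolding k O.nat_pow_Suc cgenideal_def using O.nat_pow_closed[OF varpi(1)] by blast
    then have "?J \<subseteq> PIdl\<^bsub>\<O>\<^esub> varpi"
      by (rule O.cgenideal_minimal[OF V.ideal_axioms])
    then have "\<one>\<^bsub>\<O>\<^esub> \<notin> ?J"
      using V.I_notcarr V.one_imp_carrier by blast
    then have nontrivial: "\<one>\<^bsub>\<O> Quot ?J\<^esub> \<noteq> \<zero>\<^bsub>\<O> Quot ?J\<^esub>"
      using coset_eq_ideal_iff[OF O.ring_axioms J O.one_closed] by (simp add: FactRing_def)
    have "h \<in> ring_hom (R Quot ?P) (\<O> Quot ?J)"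
      using h by (simp add: algebra_iso_def algebra_hom_def ring_hom_quotient_algebra
          FactRing_regular_algebra)
    then have proper: "?P \<noteq> carrier R"
      by (rule ideal_proper_if_quotient_maps_to_nontrivial[OF R.ring_axioms P _
            ideal.quotient_is_ring[OF J] nontrivial])
    have "?a \<odot>\<^bsub>R\<^esub> \<one>\<^bsub>R\<^esub> \<in> ?P"
      by (rule smult_one_in_ideal_if_quotient_iso[OF R(1) P J O.cgenideal_self[OF a(1)] h])
    then obtain v where v: "v \<in> carrier R" "?a \<odot>\<^bsub>R\<^esub> \<one>\<^bsub>R\<^esub> = v \<otimes>\<^bsub>R\<^esub> \<pi>"
      by (auto simp: cgenideal_def)
    have "?a \<odot>\<^bsub>S\<^esub> \<one>\<^bsub>S\<^esub> = \<phi> v \<otimes>\<^bsub>S\<^esub> ?T"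
      using \<phi>(2)[OF a(1) R.one_closed] v \<pi> by simp
    then have "?a \<odot>\<^bsub>S\<^esub> \<one>\<^bsub>S\<^esub> \<in> ?Q" using v by (auto simp: cgenideal_def)
    then show "\<phi> \<in> algebra_iso \<O> R S"
      using torsion_free[OF a]
      by (intro iso inj_if_nonzerodivisor_in_ideal[OF R(3,2,4) S.is_cring S(2)
            hom.ring_hom_ring_axioms \<pi> proper ker1])
  next
    assume *: "algebra_iso \<O> (quotient_algebra R ?P) (regular_algebra \<O>) \<noteq> {} \<and>
          phi_n S \<phi> \<pi> 2 \<in> Group.iso (principal_subquotient R \<pi>) (principal_subquotient S ?T)"
    then obtain h where "h \<in> algebra_iso \<O> (quotient_algebra R ?P) (regular_algebra \<O>)" by blast
    then have "h \<in> ring_hom (R Quot ?P) \<O>"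
      by (simp add: algebra_iso_def algebra_hom_def ring_hom_quotient_algebra
          ring_hom_regular_algebra)
    then have proper: "?P \<noteq> carrier R"
      by (rule ideal_proper_if_quotient_maps_to_nontrivial[OF R.ring_axioms P _
            O.ring_axioms O.one_not_zero])
    let ?P2 = "PIdl\<^bsub>R\<^esub> (\<pi> [^]\<^bsub>R\<^esub> (2::nat))" and ?Q2 = "PIdl\<^bsub>S\<^esub> (?T [^]\<^bsub>S\<^esub> (2::nat))"
    have P2: "ideal ?P2 R" using \<pi> by (intro R.cgenideal_ideal) simp
    have Q2: "ideal ?Q2 S" using \<pi> by (intro S.cgenideal_ideal) simp
    have image: "\<phi> ` ?P2 \<subseteq> ?Q2"
      using \<pi> by (auto simp: cgenideal_def hom.hom_nat_pow)
    \<comment> \<open>The domain of \<open>\<phi>\<^sub>2\<close> consists of the cosets of elements of \<open>\<pi>R\<close> only,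
      so \<open>x \<in> \<pi>R\<close> has to be known first.\<close>
    have ker2: "x \<in> ?P2" if x: "x \<in> carrier R" "\<phi> x = \<zero>\<^bsub>S\<^esub>" for x
    proof -
      have zero: "\<zero>\<^bsub>R\<^esub> \<in> ?P" "\<zero>\<^bsub>R\<^esub> \<in> ?P2"
        using P P2 additive_subgroup.zero_closed ideal.axioms(1) by blast+
      have "phi_n S \<phi> \<pi> 2 (?P2 +>\<^bsub>R\<^esub> x) = phi_n S \<phi> \<pi> 2 (?P2 +>\<^bsub>R\<^esub> \<zero>\<^bsub>R\<^esub>)"
        using x by (simp add: phi_n_def quot_map_coset[OF hom.ring_hom_ring_axioms P2 Q2 image])
      moreover have "inj_on (phi_n S \<phi> \<pi> 2) (carrier (principal_subquotient R \<pi>))"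
        using * by (simp add: Group.iso_def bij_betw_def)
      ultimately have "?P2 +>\<^bsub>R\<^esub> x = ?P2 +>\<^bsub>R\<^esub> \<zero>\<^bsub>R\<^esub>"
        using ker1[OF x] zero(1) by (auto simp: carrier_principal_subquotient dest: inj_onD)
      also have "\<dots> = ?P2"
        using coset_eq_ideal_iff[OF R.ring_axioms P2] zero(2) by simp
      finally show ?thesis using coset_eq_ideal_iff[OF R.ring_axioms P2 x(1)] by simp
    qed
    obtain n :: nat where n: "n \<noteq> 0" "add_pow S n ?T \<in> ?Q2"
      using finite_principal_subquotient_killed[OF S.is_cring _ assms(13)] \<pi> by auto
    let ?a = "add_pow \<O> n \<one>\<^bsub>\<O>\<^esub>"
    have a: "?a \<in> carrier \<O>" "?a \<noteq> \<zero>\<^bsub>\<O>\<^esub>"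
      using ring_of_integers_char_zero[OF assms(1,2) n(1)] by (simp_all add: assms(3)[symmetric])
    have "add_pow \<O> m \<one>\<^bsub>\<O>\<^esub> \<odot>\<^bsub>S\<^esub> ?T = add_pow S m ?T" for m :: nat
      using \<pi> by (induction m) (simp_all add: algS.smult_l_distr)
    then have "(?a \<odot>\<^bsub>S\<^esub> \<one>\<^bsub>S\<^esub>) \<otimes>\<^bsub>S\<^esub> ?T \<in> ?Q2"
      using n(2) a(1) \<pi> by (simp add: algS.smult_assoc2)
    then show "\<phi> \<in> algebra_iso \<O> R S"
      by (intro iso inj_if_nonzerodivisor_kills_subquotient[OF R(3,2,4) S.is_cring S(2)
            hom.ring_hom_ring_axioms \<pi> proper ker2
            algS.smult_closed[OF a(1) S.one_closed] torsion_free[OF a]])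
  qed
qed

end
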